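(* Let $\mathbb{G}$ be a homogeneous group of homogeneous dimension $Q$ and let $|\cdot|$ be a homogeneous quasi-norm on $\mathbb{G}$. Let $K_{\alpha,\gamma}(x)=\frac{|x|^{\alpha-Q}}{(1+|x|)^{\gamma}}$. If $0<\alpha<Q$ and $\gamma>0$, then for every $p_1$ with $\frac{Q}{Q+\gamma-\alpha}<p_{1}<\frac{Q}{Q-\alpha}$ we have $K_{\alpha,\gamma}\in L^{p_1}(\mathbb{G})$ and, for any $R>0$, $$\|K_{\alpha,\gamma}\|_{L^{p_{1}}(\mathbb{G})}\sim\left(\sum_{k\in\mathbb{Z}}\frac{(2^{k}R)^{(\alpha-Q)p_{1}+Q}}{(1+2^{k}R)^{\gamma p_{1}}}\right)^{1/p_{1}}.$$
   Context: A homogeneous group $\mathbb{G}$ is a connected simply connected Lie group whose Lie algebra $\mathfrak{g}$ is equipped with dilations $D_\lambda=\mathrm{Exp}(A\ln\lambda)$, $\lambda>0$, where $A$ is a diagonalisable linear operator on $\mathfrak g$ with positive eigenvalues and each $D_\lambda$ is a Lie algebra morphism; the dilations are transported to $\mathbb{G}$ by the exponential map (a global diffeomorphism) and written $x\mapsto\lambda x$. The homogeneous dimension is $Q=\mathrm{Tr}\,A$. A homogeneous quasi-norm is a continuous function $|\cdot|:\mathbb{G}\to[0,\infty)$ with $|x^{-1}|=|x|$, $|\lambda x|=\lambda|x|$ for $\lambda>0$, and $|x|=0$ if and only if $x$ is the identity element. $dx$ denotes the Haar measure (Lebesgue measure in exponential coordinates). For $0<p<\infty$, $\|f\|_{L^p(\mathbb{G})}=(\int_{\mathbb{G}}|f|^p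 dx)^{1/p}$. The notation $A\sim B$ means that $c_1B\le A\le c_2B$ for positive constants $c_1,c_2$, here independent of $R$. *)

theory Defs
  imports "HOL-Analysis.Analysis" "HOL-Algebra.Group"
begin

section \<open>Smooth maps and Lie groups\<close>

text \<open>For an open set S, \<open>smooth_on S f\<close> says that f is infinitely differentiable on S:
  all iterated directional derivatives exist and are (Frechet) differentiable on S.\<close>

fun times_differentiable_on ::
  "nat \<Rightarrow> 'a::real_normed_vector set \<Rightarrow> ('a \<Rightarrow> 'b::real_normed_vector) \<Rightarrow> bool" where
  "times_differentiable_on 0 S f \<longleftrightarrow> continuous_on S f"
| "times_differentiable_on (Suc n) S f \<longleftrightarrow>
     (\<forall>x\<in>S. f differentiable (at x)) \<and>
     (\<forall>v. times_differentiable_on n S (\<lambda>x. frechet_derivative f (at x) v))"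

definition smooth_on ::
  "'a::real_normed_vector set \<Rightarrow> ('a \<Rightarrow> 'b::real_normed_vector) \<Rightarrow> bool" where
  "smooth_on S f \<longleftrightarrow> (\<forall>n. times_differentiable_on n S f)"

text \<open>A chart is a pair of its domain and its coordinate map; the coordinate map is irrelevant
  outside the domain. Atlases are not required to be maximal.\<close>

type_synonym ('g, 'e) chart = "'g set \<times> ('g \<Rightarrow> 'e)"

definition smooth_atlas :: "('g::topological_space, 'e::euclidean_space) chart set \<Rightarrow> bool" where
  "smooth_atlas \<A> \<longleftrightarrow>
     (\<Union>(U, \<phi>)\<in>\<A>. U) = UNIV \<and>
     (\<forall>(U, \<phi>)\<in>\<A>. open U \<and> open (\<phi> ` U) \<and> homeomorphism U (\<phi> ` U) \<phi> (inv_into U \<phi>)) \<and>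
     (\<forall>(U, \<phi>)\<in>\<A>. \<forall>(V, \<psi>)\<in>\<A>. smooth_on (\<phi> ` (U \<inter> V)) (\<psi> \<circ> inv_into U \<phi>))"

definition smooth_map ::
  "('g::topological_space, 'd::euclidean_space) chart set \<Rightarrow>
   ('h::topological_space, 'e::euclidean_space) chart set \<Rightarrow> ('g \<Rightarrow> 'h) \<Rightarrow> bool" where
  "smooth_map \<A> \<B> f \<longleftrightarrow> continuous_on UNIV f \<and>
     (\<forall>(U, \<phi>)\<in>\<A>. \<forall>(V, \<psi>)\<in>\<B>. smooth_on (\<phi> ` (U \<inter> f -` V)) (\<psi> \<circ> f \<circ> inv_into U \<phi>))"

definition std_atlas :: "('e, 'e::euclidean_space) chart set" where
  "std_atlas = {(UNIV, \<lambda>x. x)}"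

definition prod_atlas ::
  "('g, 'd) chart set \<Rightarrow> ('h, 'e) chart set \<Rightarrow> ('g \<times> 'h, 'd \<times> 'e) chart set" where
  "prod_atlas \<A> \<B> = (\<lambda>((U, \<phi>), (V, \<psi>)). (U \<times> V, map_prod \<phi> \<psi>)) ` (\<A> \<times> \<B>)"

locale lie_group = group G
  for G :: "'g::{t2_space, second_countable_topology} monoid"
    and \<A> :: "('g, 'e::euclidean_space) chart set" +
  assumes carrier_UNIV: "carrier G = UNIV"
    and atlas: "smooth_atlas \<A>"
    and smooth_mult: "smooth_map (prod_atlas \<A> \<A>) \<A> (\<lambda>(x, y). x \<otimes>\<^bsub>G\<^esub> y)"
    and smooth_inv: "smooth_map \<A> \<A> (\<lambda>x. inv\<^bsub>G\<^esub> x)"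

text \<open>The derivative along the left-invariant vector field generated by v, given the
  exponential map E of the group.\<close>

definition left_inv_field ::
  "('g, 'b) monoid_scheme \<Rightarrow> ('e::real_vector \<Rightarrow> 'g) \<Rightarrow> 'e \<Rightarrow> ('g \<Rightarrow> real) \<Rightarrow> 'g \<Rightarrow> real" where
  "left_inv_field G E v f x = deriv (\<lambda>t. f (x \<otimes>\<^bsub>G\<^esub> E (t *\<^sub>R v))) 0"

section \<open>Dilations\<close>

text \<open>The exponential of a linear operator, as a pointwise convergent power series.\<close>

definition op_exp :: "('e::real_normed_vector \<Rightarrow> 'e) \<Rightarrow> 'e \<Rightarrow> 'e" where
  "op_exp T x = (\<Sum>n. (1 / fact n) *\<^sub>R (T ^^ n) x)"

definition op_trace :: "('e::euclidean_space \<Rightarrow> 'e) \<Rightarrow> real" where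
  "op_trace T = (\<Sum>b\<in>Basis. T b \<bullet> b)"

definition diagonalisable_pos :: "('e::real_vector \<Rightarrow> 'e) \<Rightarrow> bool" where
  "diagonalisable_pos T \<longleftrightarrow>
     (\<exists>B. independent B \<and> span B = UNIV \<and> (\<forall>b\<in>B. \<exists>\<mu>>0. T b = \<mu> *\<^sub>R b))"

definition alg_dilation :: "('e::real_normed_vector \<Rightarrow> 'e) \<Rightarrow> real \<Rightarrow> 'e \<Rightarrow> 'e" where
  "alg_dilation A r = op_exp (\<lambda>x. ln r *\<^sub>R A x)"

definition lie_algebra_morphism ::
  "('e::real_vector \<Rightarrow> 'e \<Rightarrow> 'e) \<Rightarrow> ('f::real_vector \<Rightarrow> 'f \<Rightarrow> 'f) \<Rightarrow> ('e \<Rightarrow> 'f) \<Rightarrow> bool" where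
  "lie_algebra_morphism br br' h \<longleftrightarrow> linear h \<and> (\<forall>u v. h (br u v) = br' (h u) (h v))"

section \<open>Homogeneous groups\<close>

text \<open>The Lie algebra of G is carried by the Euclidean space \<open>'e\<close>, with bracket \<open>br\<close> and
  exponential map \<open>E\<close>. A diffeomorphism E whose restriction to every line through 0 is a
  one-parameter subgroup is the exponential map of G under the identification of \<open>'e\<close> with the
  tangent space at the identity given by the derivative of E at 0; the bracket is then
  determined by the commutators of left-invariant vector fields. That E is a global
  diffeomorphism holds for every connected simply connected Lie group with such dilations.\<close>

locale homogeneous_group = lie_group G \<A>
  for G :: "'g::{t2_space, second_countable_topology} monoid"
    and \<A> :: "('g, 'e::euclidean_space) chart set" +
  fixes br :: "'e \<Rightarrow> 'e \<Rightarrow> 'e"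
    and E :: "'e \<Rightarrow> 'g"
    and A :: "'e \<Rightarrow> 'e"
  assumes connected: "connected (UNIV :: 'g set)"
    and simply_connected: "simply_connected (UNIV :: 'g set)"
    and E_add: "E ((s + t) *\<^sub>R v) = E (s *\<^sub>R v) \<otimes>\<^bsub>G\<^esub> E (t *\<^sub>R v)"
    and E_bij: "bij E"
    and E_smooth: "smooth_map std_atlas \<A> E"
    and E_inv_smooth: "smooth_map \<A> std_atlas (inv_into UNIV E)"
    and bracket: "smooth_map \<A> std_atlas f \<Longrightarrow>
       left_inv_field G E (br u v) f x =
         left_inv_field G E u (left_inv_field G E v f) x -
         left_inv_field G E v (left_inv_field G E u f) x"
    and A_linear: "linear A"
    and A_diag: "diagonalisable_pos A"
    and dilation_morphism: "r > 0 \<Longrightarrow> lie_algebra_morphism br br (alg_dilation A r)"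

definition dilation ::
  "('e::real_normed_vector \<Rightarrow> 'g) \<Rightarrow> ('e \<Rightarrow> 'e) \<Rightarrow> real \<Rightarrow> 'g \<Rightarrow> 'g" where
  "dilation E A r x = E (alg_dilation A r (inv_into UNIV E x))"

definition homogeneous_dim :: "('e::euclidean_space \<Rightarrow> 'e) \<Rightarrow> real" where
  "homogeneous_dim A = op_trace A"

definition haar :: "('e::euclidean_space \<Rightarrow> 'g::topological_space) \<Rightarrow> 'g measure" where
  "haar E = distr lborel borel E"

definition homogeneous_quasinorm ::
  "('g::topological_space, 'b) monoid_scheme \<Rightarrow> ('e::real_normed_vector \<Rightarrow> 'g) \<Rightarrow> ('e \<Rightarrow> 'e) \<Rightarrow>
   ('g \<Rightarrow> real) \<Rightarrow> bool" where
  "homogeneous_quasinorm G E A N \<longleftrightarrow>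
     continuous_on UNIV N \<and>
     (\<forall>x. N x \<ge> 0) \<and>
     (\<forall>x. N (inv\<^bsub>G\<^esub> x) = N x) \<and>
     (\<forall>r>0. \<forall>x. N (dilation E A r x) = r * N x) \<and>
     (\<forall>x. N x = 0 \<longleftrightarrow> x = \<one>\<^bsub>G\<^esub>)"

section \<open>Lebesgue spaces and the kernel\<close>

definition Lp_space :: "real \<Rightarrow> 'a measure \<Rightarrow> ('a \<Rightarrow> real) set" where
  "Lp_space p M = {f \<in> borel_measurable M. integrable M (\<lambda>x. \<bar>f x\<bar> powr p)}"

definition Lp_norm :: "real \<Rightarrow> 'a measure \<Rightarrow> ('a \<Rightarrow> real) \<Rightarrow> real" where
  "Lp_norm p M f = (LINT x|M. \<bar>f x\<bar> powr p) powr (1 / p)"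

text \<open>At the identity, a null set, the kernel is infinite for \<open>\<alpha> < Q\<close>; here it is 0 there,
  since \<open>0 powr a = 0\<close>.\<close>

definition BR_kernel :: "('g \<Rightarrow> real) \<Rightarrow> real \<Rightarrow> real \<Rightarrow> real \<Rightarrow> 'g \<Rightarrow> real" where
  "BR_kernel N Q \<alpha> \<gamma> x = N x powr (\<alpha> - Q) / (1 + N x) powr \<gamma>"

end

theory Submission
  imports Defs
begin

text \<open>The kernel is a decreasing function of the quasi-norm \<open>N\<close>, so its \<open>L\<^sup>p\<close> norm depends only on the
volumes of the quasi-norm balls. In exponential coordinates the dilation by \<open>r\<close> is a linear map that
multiplies volumes by \<open>r\<^sup>Q\<close> (\<open>lborel_alg_dilation\<close>), whence the ball of radius \<open>s\<close> has volume
\<open>V s\<^sup>Q\<close>; a compactness argument on the unit sphere shows \<open>0 < V < \<infinity>\<close>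
(\<open>emeasure_homogeneous_sublevel\<close>).

Now cut the group into the shells \<open>2\<^sup>k R < N \<le> 2\<^sup>k\<^sup>+\<^sup>1 R\<close>, \<open>k \<in> \<int>\<close>. On each of them the function
\<open>F(s) = s\<^sup>a / (1 + s)\<^sup>c\<close>, with \<open>a = (\<alpha> - Q) p\<^sub>1\<close> and \<open>c = \<gamma> p\<^sub>1\<close>, varies at most by the factor
\<open>2\<^sup>c\<^sup>-\<^sup>a\<close>, and the shell has volume \<open>V (2\<^sup>Q - 1) (2\<^sup>k R)\<^sup>Q\<close>. Summing over \<open>k\<close> compares the integral of
\<open>F \<circ> N\<close> with the dyadic sum, with constants that depend neither on \<open>k\<close> nor on \<open>R\<close>
(\<open>nn_integral_dyadic_shells\<close>). The two bounds on \<open>p\<^sub>1\<close> say exactly that the summand decays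
geometrically as \<open>k \<rightarrow> -\<infinity>\<close> and as \<open>k \<rightarrow> \<infinity>\<close>, so the sum is finite; hence the kernel lies in \<open>L\<^sup>p\<close>.
Taking \<open>p\<^sub>1\<close>-th roots gives the theorem.\<close>

section \<open>Linear bijections scale Lebesgue measure\<close>

lemma emeasure_lborel_open_pos:
  fixes S :: "'e::euclidean_space set"
  assumes "open S" "S \<noteq> {}"
  shows "0 < emeasure lborel S"
proof -
  have "S \<notin> null_sets lebesgue"
    using open_not_negligible[OF assms] by (simp add: negligible_iff_null_sets)
  then have "S \<notin> null_sets lborel"
    by (meson null_sets_completionI)
  then show ?thesis
    using assms(1) by (simp add: null_sets_def zero_less_iff_neq_zero)
qed

lemma nn_integral_lborel_translate:
  fixes f :: "'e::euclidean_space \<Rightarrow> ennreal"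
  assumes [measurable]: "f \<in> borel_measurable borel"
  shows "(\<integral>\<^sup>+x. f (c + x) \<partial>lborel) = (\<integral>\<^sup>+x. f x \<partial>lborel)"
proof -
  have "(\<integral>\<^sup>+x. f x \<partial>lborel) = (\<integral>\<^sup>+x. f x \<partial>distr lborel borel ((+) c))"
    by (simp only: lborel_distr_plus)
  also have "\<dots> = (\<integral>\<^sup>+x. f (c + x) \<partial>lborel)"
    by (rule nn_integral_distr) auto
  finally show ?thesis ..
qed

text \<open>The usual argument that a translation invariant measure is a multiple of Lebesgue measure
\<open>\<lambda>\<close>, for \<open>\<nu> = \<lambda> \<circ> P\<^sup>-\<^sup>1\<close>. The product \<open>\<nu>(X) \<lambda>(B)\<close> is the integral of \<open>1\<^sub>X(P x) 1\<^sub>B(y)\<close>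
over pairs \<open>(x, y)\<close>; translating \<open>x\<close> by \<open>P' y\<close>, then \<open>y\<close> by \<open>-P x\<close>, then \<open>x\<close> again by
\<open>P' y\<close>, turns it into the integral of \<open>1\<^sub>X(y) 1\<^sub>B(-P x)\<close>, which is \<open>\<lambda>(X) \<nu>(B)\<close> because the
ball \<open>B\<close> is symmetric.\<close>

lemma lborel_vimage_linear_cross:
  fixes P P' :: "'e::euclidean_space \<Rightarrow> 'e"
  assumes P: "linear P" and PP': "\<And>x. P (P' x) = x"
    and X: "X \<in> sets borel"
  shows "emeasure lborel (P -` X) * emeasure lborel (ball 0 1 :: 'e set) =
    emeasure lborel X * emeasure lborel (P -` ball 0 1)"
proof -
  define B where "B = (ball 0 1 :: 'e set)"
  have [measurable]: "P \<in> borel_measurable borel"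
    using P by (simp add: borel_measurable_continuous_onI linear_conv_bounded_linear linear_continuous_on)
  note [measurable] = X
  have B[measurable]: "B \<in> sets borel" by (simp add: B_def)
  have [measurable]: "P -` X \<in> sets borel" "P -` B \<in> sets borel"
    using measurable_sets_borel[of P borel] X B by auto
  define F :: "'e \<Rightarrow> 'e \<Rightarrow> ennreal" where "F x y = indicator X (P x + y) * indicator B y" for x y
  define H :: "'e \<Rightarrow> 'e \<Rightarrow> ennreal" where "H x y = indicator X y * indicator B (y - P x)" for x y
  have [measurable]: "(\<lambda>(x, y). F x y) \<in> borel_measurable (lborel \<Otimes>\<^sub>M lborel)"
      "(\<lambda>(x, y). H x y) \<in> borel_measurable (lborel \<Otimes>\<^sub>M lborel)"
    unfolding F_def H_def by measurable
  have "emeasure lborel (P -` X) * emeasure lborel B =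
      (\<integral>\<^sup>+y. (\<integral>\<^sup>+x. indicator X (P x) \<partial>lborel) * indicator B y \<partial>lborel)"
  proof -
    have "(\<integral>\<^sup>+x. indicator X (P x) \<partial>lborel) = (\<integral>\<^sup>+x. (indicator (P -` X) x :: ennreal) \<partial>lborel)"
      by (rule nn_integral_cong) (simp add: indicator_def)
    then show ?thesis by (simp add: nn_integral_cmult)
  qed
  also have "\<dots> = (\<integral>\<^sup>+y. \<integral>\<^sup>+x. F x y \<partial>lborel \<partial>lborel)"
  proof (rule nn_integral_cong)
    fix y :: 'e
    have "(\<integral>\<^sup>+x. indicator X (P x) \<partial>lborel) =
        (\<integral>\<^sup>+x. (indicator X (P (P' y + x)) :: ennreal) \<partial>lborel)"
      by (rule nn_integral_lborel_translate[symmetric]) measurable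
    also have "\<dots> = (\<integral>\<^sup>+x. indicator X (P x + y) \<partial>lborel)"
      by (simp add: linear_add[OF P] PP' add.commute)
    finally have *: "(\<integral>\<^sup>+x. indicator X (P x) \<partial>lborel) = (\<integral>\<^sup>+x. (indicator X (P x + y) :: ennreal) \<partial>lborel)" .
    show "(\<integral>\<^sup>+x. indicator X (P x) \<partial>lborel) * indicator B y = (\<integral>\<^sup>+x. F x y \<partial>lborel)"
      unfolding F_def * by (rule nn_integral_multc[symmetric]) measurable
  qed
  also have "\<dots> = (\<integral>\<^sup>+x. \<integral>\<^sup>+y. F x y \<partial>lborel \<partial>lborel)"
    by (rule lborel_pair.Fubini') measurable
  also have "\<dots> = (\<integral>\<^sup>+x. \<integral>\<^sup>+y. H x y \<partial>lborel \<partial>lborel)"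
  proof (rule nn_integral_cong)
    fix x :: 'e
    have "(\<integral>\<^sup>+y. H x y \<partial>lborel) = (\<integral>\<^sup>+y. H x (P x + y) \<partial>lborel)"
      by (rule nn_integral_lborel_translate[symmetric]) (simp add: H_def)
    then show "(\<integral>\<^sup>+y. F x y \<partial>lborel) = (\<integral>\<^sup>+y. H x y \<partial>lborel)"
      by (simp add: F_def H_def)
  qed
  also have "\<dots> = (\<integral>\<^sup>+y. \<integral>\<^sup>+x. H x y \<partial>lborel \<partial>lborel)"
    by (rule lborel_pair.Fubini'[symmetric]) measurable
  also have "\<dots> = (\<integral>\<^sup>+y. indicator X y * emeasure lborel (P -` B) \<partial>lborel)"
  proof (rule nn_integral_cong)
    fix y :: 'e
    have "(\<integral>\<^sup>+x. H x y \<partial>lborel) = (\<integral>\<^sup>+x. H (P' y + x) y \<partial>lborel)"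
      by (rule nn_integral_lborel_translate[symmetric]) (simp add: H_def)
    also have "\<dots> = (\<integral>\<^sup>+x. indicator X y * indicator (P -` B) x \<partial>lborel)"
      by (rule nn_integral_cong) (simp add: H_def linear_add[OF P] PP' B_def indicator_def)
    also have "\<dots> = indicator X y * emeasure lborel (P -` B)"
      by (simp add: nn_integral_cmult)
    finally show "(\<integral>\<^sup>+x. H x y \<partial>lborel) = indicator X y * emeasure lborel (P -` B)" .
  qed
  also have "\<dots> = emeasure lborel X * emeasure lborel (P -` B)"
    using X by (simp add: nn_integral_multc)
  finally show ?thesis by (simp add: B_def)
qed

lemma ennreal_positive_finiteE:
  assumes "0 < x" "x < \<infinity>"
  obtains r where "0 < r" "x = ennreal r"
  using assms by (cases x) auto

text \<open>The constant is \<open>\<nu>(B) / \<lambda>(B)\<close> for the unit ball \<open>B\<close>; it is positive because \<open>P -` B\<close> is open and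
nonempty, and finite because \<open>P -` B\<close> is bounded. It equals \<open>\<bar>det P'\<bar>\<close>.\<close>

lemma lborel_vimage_linear:
  fixes P P' :: "'e::euclidean_space \<Rightarrow> 'e"
  assumes P: "linear P" and P': "linear P'" and PP': "\<And>x. P (P' x) = x" and P'P: "\<And>x. P' (P x) = x"
  obtains C where "0 < C" "\<And>X. X \<in> sets borel \<Longrightarrow> emeasure lborel (P -` X) = ennreal C * emeasure lborel X"
proof -
  define B where "B = (ball 0 1 :: 'e set)"
  have cont: "continuous_on UNIV P"
    using P by (simp add: linear_conv_bounded_linear linear_continuous_on)
  have fin: "emeasure lborel B < \<infinity>"
    unfolding B_def by (rule emeasure_bounded_finite) simp
  have pos: "0 < emeasure lborel B"
    unfolding B_def by (rule emeasure_lborel_open_pos) auto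
  have "P -` B \<subseteq> P' ` B"
    using P'P by (metis image_eqI subsetI vimageE)
  moreover have "bounded (P' ` B)"
    using P' by (simp add: B_def bounded_linear_image linear_conv_bounded_linear)
  ultimately have "emeasure lborel (P -` B) < \<infinity>"
    by (meson bounded_subset emeasure_bounded_finite)
  moreover have "0 < emeasure lborel (P -` B)"
  proof (rule emeasure_lborel_open_pos)
    show "open (P -` B)" using cont by (simp add: B_def open_vimage)
    show "P -` B \<noteq> {}" using linear_0[OF P] by (auto simp: B_def vimage_def intro!: exI[of _ 0])
  qed
  ultimately obtain b where b: "0 < b" "emeasure lborel (P -` B) = ennreal b"
    using ennreal_positive_finiteE by blast
  obtain a where a: "0 < a" "emeasure lborel B = ennreal a"
    using ennreal_positive_finiteE[OF pos fin] .
  show ?thesis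
  proof
    show "0 < b / a" using a b by simp
    fix X :: "'e set" assume "X \<in> sets borel"
    then have "emeasure lborel (P -` X) * ennreal a = emeasure lborel X * ennreal b"
      using lborel_vimage_linear_cross[OF P PP', of X] a b by (simp add: B_def)
    also have "\<dots> = ennreal (b / a) * emeasure lborel X * ennreal a"
    proof -
      have "ennreal b = ennreal (b / a) * ennreal a"
        using a(1) b(1) by (simp flip: ennreal_mult)
      then show ?thesis by (simp add: mult_ac)
    qed
    finally show "emeasure lborel (P -` X) = ennreal (b / a) * emeasure lborel X"
      using a(1) by (simp add: mult_right_ennreal_cancel)
  qed
qed

section \<open>The algebra dilations and their effect on volume\<close>

text \<open>The algebra dilation in coordinates in which \<open>A\<close> is diagonal with entries \<open>\<mu>\<close>. As
\<open>0 powr m = 0\<close>, this is also meaningful at \<open>r = 0\<close>, where for \<open>\<mu> > 0\<close> it extends the family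
continuously by the zero map.\<close>

definition diag_dilation :: "('e::euclidean_space \<Rightarrow> real) \<Rightarrow> real \<Rightarrow> 'e \<Rightarrow> 'e" where
  "diag_dilation \<mu> r x = (\<Sum>b\<in>Basis. (r powr \<mu> b * (x \<bullet> b)) *\<^sub>R b)"

lemma lborel_vimage_diag_dilation:
  fixes X :: "'e::euclidean_space set"
  assumes "0 < r" and [measurable]: "X \<in> sets borel"
  shows "emeasure lborel X = ennreal (r powr (\<Sum>b\<in>Basis. \<mu> b)) * emeasure lborel (diag_dilation \<mu> r -` X)"
proof -
  have [measurable]: "diag_dilation \<mu> r \<in> borel_measurable borel"
    unfolding diag_dilation_def by measurable
  have T: "diag_dilation \<mu> r = (\<lambda>x. 0 + (\<Sum>b\<in>Basis. (r powr \<mu> b * (x \<bullet> b)) *\<^sub>R b))"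
    by (simp add: diag_dilation_def fun_eq_iff)
  have "emeasure lborel X = emeasure (density (distr lborel borel (diag_dilation \<mu> r)) (\<lambda>_. \<Prod>b\<in>Basis. \<bar>r powr \<mu> b\<bar>)) X"
    unfolding T using assms
    by (intro arg_cong2[where f = emeasure] lborel_affine_euclidean refl) auto
  also have "\<dots> = ennreal (\<Prod>b\<in>Basis. \<bar>r powr \<mu> b\<bar>) * emeasure lborel (diag_dilation \<mu> r -` X)"
    by (simp add: emeasure_density nn_integral_cmult emeasure_distr)
  also have "(\<Prod>b\<in>Basis. \<bar>r powr \<mu> b\<bar>) = r powr (\<Sum>b\<in>Basis. \<mu> b)"
    using assms by (simp add: powr_sum)
  finally show ?thesis .
qed

text \<open>Invariance of the trace under the change of basis \<open>P\<close>, that is \<open>Tr (P D P') = Tr (D P' P) = Tr D\<close>,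
by exchanging the two summations over the basis.\<close>

lemma op_trace_conj_diag:
  fixes A P P' :: "'e::euclidean_space \<Rightarrow> 'e"
  assumes "linear A" and P: "linear P" and P': "linear P'"
    and PP': "\<And>x. P (P' x) = x" and P'P: "\<And>x. P' (P x) = x"
    and eig: "\<And>b. b \<in> Basis \<Longrightarrow> A (P b) = \<mu> b *\<^sub>R P b"
  shows "op_trace A = (\<Sum>b\<in>Basis. \<mu> b)"
proof -
  have A_expand: "A v = (\<Sum>c\<in>Basis. (P' v \<bullet> c * \<mu> c) *\<^sub>R P c)" for v
  proof -
    have "A v = A (P (\<Sum>c\<in>Basis. (P' v \<bullet> c) *\<^sub>R c))"
      by (simp add: euclidean_representation PP')
    also have "\<dots> = (\<Sum>c\<in>Basis. (P' v \<bullet> c) *\<^sub>R A (P c))"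
      using assms by (simp add: linear_sum linear_cmul)
    finally show ?thesis by (simp add: eig)
  qed
  have "op_trace A = (\<Sum>b\<in>Basis. \<Sum>c\<in>Basis. P' b \<bullet> c * \<mu> c * (P c \<bullet> b))"
    unfolding op_trace_def by (subst A_expand) (simp add: inner_sum_left)
  also have "\<dots> = (\<Sum>c\<in>Basis. \<mu> c * (\<Sum>b\<in>Basis. (P c \<bullet> b) * (P' b \<bullet> c)))"
    by (subst sum.swap) (simp add: sum_distrib_left mult_ac)
  also have "\<dots> = (\<Sum>c\<in>Basis. \<mu> c)"
  proof (rule sum.cong[OF refl])
    fix c :: 'e assume c: "c \<in> Basis"
    have "P' (P c) = (\<Sum>b\<in>Basis. (P c \<bullet> b) *\<^sub>R P' b)"
      by (subst euclidean_representation[of "P c", symmetric])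
         (simp only: linear_sum[OF P'] linear_cmul[OF P'])
    then have "(\<Sum>b\<in>Basis. (P c \<bullet> b) * (P' b \<bullet> c)) = P' (P c) \<bullet> c"
      by (simp only: inner_sum_left inner_scaleR_left)
    then show "\<mu> c * (\<Sum>b\<in>Basis. (P c \<bullet> b) * (P' b \<bullet> c)) = \<mu> c"
      using c by (simp add: P'P)
  qed
  finally show ?thesis .
qed

lemma alg_dilation_conj_diag:
  fixes A P :: "'e::euclidean_space \<Rightarrow> 'e"
  assumes A: "linear A" and P: "linear P" and "0 < r"
    and eig: "\<And>b. b \<in> Basis \<Longrightarrow> A (P b) = \<mu> b *\<^sub>R P b"
  shows "alg_dilation A r (P x) = P (diag_dilation \<mu> r x)"
proof -
  let ?T = "\<lambda>x. ln r *\<^sub>R A x"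
  have pw: "(?T ^^ n) (P x) = (\<Sum>b\<in>Basis. (ln r * \<mu> b) ^ n *\<^sub>R (x \<bullet> b) *\<^sub>R P b)" for n
  proof (induction n)
    case 0
    have "P x = P (\<Sum>b\<in>Basis. (x \<bullet> b) *\<^sub>R b)" by (simp add: euclidean_representation)
    then show ?case by (simp add: linear_sum[OF P] linear_cmul[OF P])
  next
    case (Suc n)
    then show ?case
      by (simp add: linear_sum[OF A] linear_cmul[OF A] eig scaleR_sum_right mult_ac)
  qed
  have "(\<lambda>n. \<Sum>b\<in>Basis. ((ln r * \<mu> b) ^ n /\<^sub>R fact n) *\<^sub>R ((x \<bullet> b) *\<^sub>R P b)) sums
      (\<Sum>b\<in>Basis. exp (ln r * \<mu> b) *\<^sub>R ((x \<bullet> b) *\<^sub>R P b))"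
    by (intro sums_sum bounded_linear.sums[OF bounded_linear_scaleR_left] exp_converges)
  then have "(\<lambda>n. (1 / fact n) *\<^sub>R (?T ^^ n) (P x)) sums
      (\<Sum>b\<in>Basis. exp (ln r * \<mu> b) *\<^sub>R ((x \<bullet> b) *\<^sub>R P b))"
    unfolding pw by (simp add: scaleR_sum_right divide_inverse mult_ac)
  then have "alg_dilation A r (P x) = (\<Sum>b\<in>Basis. exp (ln r * \<mu> b) *\<^sub>R ((x \<bullet> b) *\<^sub>R P b))"
    by (simp add: alg_dilation_def op_exp_def sums_iff)
  also have "\<dots> = P (diag_dilation \<mu> r x)"
    using \<open>0 < r\<close> by (simp add: diag_dilation_def linear_sum[OF P] linear_cmul[OF P] powr_def mult_ac)
  finally show ?thesis .
qed

text \<open>\<open>P\<close> sends the standard basis to a basis of eigenvectors.\<close>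

lemma diagonalisable_pos_obtains_coordinates:
  fixes A :: "'e::euclidean_space \<Rightarrow> 'e"
  assumes "diagonalisable_pos A"
  obtains P P' :: "'e \<Rightarrow> 'e" and \<mu> where "linear P" "linear P'" "\<And>x. P (P' x) = x" "\<And>x. P' (P x) = x"
    "\<And>b. b \<in> Basis \<Longrightarrow> 0 < \<mu> b" "\<And>b. b \<in> Basis \<Longrightarrow> A (P b) = \<mu> b *\<^sub>R P b"
proof -
  obtain B where B: "independent B" "span B = UNIV" and eig: "\<forall>b\<in>B. \<exists>\<mu>>0. A b = \<mu> *\<^sub>R b"
    using assms by (auto simp: diagonalisable_pos_def)
  have "finite B" using B(1) by (rule finiteI_independent)
  moreover have "card B = DIM('e)"
    using dim_eq_card[of B UNIV] B by simp
  ultimately obtain f where f: "bij_betw f (Basis :: 'e set) B"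
    by (metis finite_Basis finite_same_card_bij)
  obtain P :: "'e \<Rightarrow> 'e" where P: "linear P" "\<forall>b\<in>Basis. P b = f b" "range P = span (f ` Basis)"
    using linear_independent_extend_subspace[OF independent_Basis, of f] by blast
  have "surj P" using P(3) f B(2) by (simp add: bij_betw_def)
  then obtain P' where P': "linear P'" "\<forall>x. P' (P x) = x" "\<forall>x. P (P' x) = x"
    using linear_surjective_isomorphism[OF P(1)] by auto
  have "\<forall>b\<in>Basis. \<exists>\<mu>>0. A (P b) = \<mu> *\<^sub>R P b"
    using eig f P(2) by (metis bij_betwE)
  then obtain \<mu> where "\<forall>b\<in>Basis. \<mu> b > 0 \<and> A (P b) = \<mu> b *\<^sub>R P b" by metis
  with P P' that show ?thesis by blast
qed

text \<open>This is where the homogeneous dimension enters. In eigenvector coordinates the dilation multiplies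
the axes by \<open>r powr \<mu> b\<close>, hence volumes by \<open>r\<close> to the sum of the eigenvalues, which is the trace;
the volume distortion of the coordinate change is the same on both sides and cancels.\<close>

lemma lborel_alg_dilation:
  fixes A :: "'e::euclidean_space \<Rightarrow> 'e"
  assumes A: "linear A" "diagonalisable_pos A" and r: "0 < r" and X: "X \<in> sets borel"
  shows "emeasure lborel X = ennreal (r powr op_trace A) * emeasure lborel (alg_dilation A r -` X)"
proof -
  obtain P P' :: "'e \<Rightarrow> 'e" and \<mu> where P: "linear P" "linear P'" "\<And>x. P (P' x) = x" "\<And>x. P' (P x) = x"
    and \<mu>: "\<And>b. b \<in> Basis \<Longrightarrow> 0 < \<mu> b" "\<And>b. b \<in> Basis \<Longrightarrow> A (P b) = \<mu> b *\<^sub>R P b"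
    using diagonalisable_pos_obtains_coordinates[OF A(2)] by blast
  obtain C where C: "0 < C" "\<And>X. X \<in> sets borel \<Longrightarrow> emeasure lborel (P -` X) = ennreal C * emeasure lborel X"
    using lborel_vimage_linear[OF P] by blast
  note conj = alg_dilation_conj_diag[OF A(1) P(1) r \<mu>(2)]
  have meas: "g \<in> borel_measurable borel" if "linear g" for g :: "'e \<Rightarrow> 'e"
    using that by (simp add: borel_measurable_continuous_onI linear_conv_bounded_linear linear_continuous_on)
  note [measurable] = meas[OF P(1)] meas[OF P(2)]
  have [measurable]: "diag_dilation \<mu> r \<in> borel_measurable borel"
    unfolding diag_dilation_def by measurable
  have "alg_dilation A r = (\<lambda>v. P (diag_dilation \<mu> r (P' v)))"
    using conj by (metis P(3))
  then have "alg_dilation A r \<in> borel_measurable borel" by simp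
  then have AX: "alg_dilation A r -` X \<in> sets borel"
    using X measurable_sets_borel by blast
  have PX: "P -` X \<in> sets borel"
    using X measurable_sets_borel[OF meas[OF P(1)]] by blast
  have "ennreal C * emeasure lborel X = emeasure lborel (P -` X)"
    using C(2)[OF X] by simp
  also have "\<dots> = ennreal (r powr op_trace A) * emeasure lborel (diag_dilation \<mu> r -` (P -` X))"
    using lborel_vimage_diag_dilation[OF r PX] op_trace_conj_diag[OF A(1) P \<mu>(2)] by simp
  also have "diag_dilation \<mu> r -` (P -` X) = P -` (alg_dilation A r -` X)"
    by (auto simp: conj)
  also have "emeasure lborel \<dots> = ennreal C * emeasure lborel (alg_dilation A r -` X)"
    by (rule C(2)[OF AX])
  finally have "ennreal C * emeasure lborel X =
      ennreal C * (ennreal (r powr op_trace A) * emeasure lborel (alg_dilation A r -` X))"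
    by (simp add: mult_ac)
  then show ?thesis
    using C(1) by (simp add: ennreal_mult_cancel_left)
qed

text \<open>Positivity of the eigenvalues makes the orbit of \<open>v\<close> run continuously into \<open>0\<close> as \<open>r\<close> decreases
from \<open>1\<close>, so it crosses the unit sphere by the intermediate value theorem.\<close>

lemma alg_dilation_meets_sphere:
  fixes A :: "'e::euclidean_space \<Rightarrow> 'e"
  assumes A: "linear A" "diagonalisable_pos A" and v: "1 \<le> norm v"
  obtains r where "0 < r" "r \<le> 1" "norm (alg_dilation A r v) = 1"
proof -
  obtain P P' :: "'e \<Rightarrow> 'e" and \<mu> where P: "linear P" "linear P'" "\<And>x. P (P' x) = x" "\<And>x. P' (P x) = x"
    and \<mu>: "\<And>b. b \<in> Basis \<Longrightarrow> 0 < \<mu> b" "\<And>b. b \<in> Basis \<Longrightarrow> A (P b) = \<mu> b *\<^sub>R P b"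
    using diagonalisable_pos_obtains_coordinates[OF A(2)] by blast
  define h where "h r = norm (P (diag_dilation \<mu> r (P' v)))" for r
  have "continuous_on {0..1} (\<lambda>r. diag_dilation \<mu> r (P' v))"
    unfolding diag_dilation_def
    by (intro continuous_intros continuous_on_powr') (auto simp: \<mu>(1))
  then have cont: "continuous_on {0..1} h"
    unfolding h_def using P(1)
    by (intro continuous_on_norm linear_continuous_on_compose[of _ _ P])
  have h0: "h 0 = 0"
    by (simp add: h_def diag_dilation_def linear_0[OF P(1)])
  have h1: "h 1 = norm v"
    by (simp add: h_def diag_dilation_def euclidean_representation P(3))
  obtain r where r: "0 \<le> r" "r \<le> 1" "h r = 1"
    using IVT'[of h 0 1 1] h0 h1 v cont by auto
  with h0 have "0 < r" by (cases "r = 0") auto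
  moreover have "norm (alg_dilation A r v) = 1"
    using r(3) alg_dilation_conj_diag[OF A(1) P(1) \<open>0 < r\<close> \<mu>(2), of "P' v"]
    by (simp add: h_def P(3))
  ultimately show ?thesis using r(2) that by blast
qed

section \<open>Volume of quasi-norm balls\<close>

text \<open>Homogeneity reduces everything to the single number \<open>V\<close>, the volume of \<open>{v. n v \<le> 1}\<close>, and the
point is that \<open>0 < V < \<infinity>\<close>. Positivity holds because \<open>{v. n v < 1}\<close> is open and contains \<open>0\<close>. For
finiteness let \<open>\<delta> > 0\<close> be the minimum of \<open>n\<close> on the unit sphere: a vector outside the unit ball is
carried to the sphere by some \<open>r \<le> 1\<close>, so its \<open>n\<close> is at least \<open>\<delta>\<close>. Thus \<open>{v. n v \<le> \<delta> / 2}\<close> is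
bounded, and scaling transfers finiteness to \<open>V\<close>.\<close>

lemma emeasure_homogeneous_sublevel:
  fixes A :: "'e::euclidean_space \<Rightarrow> 'e" and n :: "'e \<Rightarrow> real"
  assumes A: "linear A" "diagonalisable_pos A"
    and cont: "continuous_on UNIV n" and nonneg: "\<And>v. 0 \<le> n v"
    and zero: "\<And>v. n v = 0 \<longleftrightarrow> v = 0"
    and hom: "\<And>r v. 0 < r \<Longrightarrow> n (alg_dilation A r v) = r * n v"
  obtains V where "0 < V" "\<And>s. 0 < s \<Longrightarrow> emeasure lborel {v. n v \<le> s} = ennreal (V * s powr op_trace A)"
proof -
  have meas: "{v. n v \<le> s} \<in> sets borel" for s
    using closed_Collect_le[OF cont continuous_on_const] by (rule borel_closed)
  have scale: "emeasure lborel {v. n v \<le> s} = ennreal (s powr op_trace A) * emeasure lborel {v. n v \<le> 1}"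
    if "0 < s" for s
  proof -
    have "alg_dilation A s -` {v. n v \<le> s} = {v. n v \<le> 1}"
      using that hom by auto
    then show ?thesis
      using lborel_alg_dilation[OF A that meas[of s]] by simp
  qed
  have "compact (sphere (0::'e) 1)" "sphere (0::'e) 1 \<noteq> {}" by auto
  then obtain u where u: "u \<in> sphere 0 1" "\<And>v. v \<in> sphere 0 1 \<Longrightarrow> n u \<le> n v"
    using continuous_attains_inf[of "sphere 0 1" n] continuous_on_subset[OF cont] by blast
  have nu: "0 < n u"
    using u(1) zero nonneg by (metis dist_0_norm less_eq_real_def mem_sphere norm_zero zero_neq_one)
  have sub: "{v. n v \<le> n u / 2} \<subseteq> ball 0 1"
  proof (rule ccontr)
    assume "\<not> ?thesis"
    then obtain v where "n v \<le> n u / 2" "v \<notin> ball 0 1" by blast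
    then have v: "n v \<le> n u / 2" "1 \<le> norm v" by auto
    obtain r where r: "0 < r" "r \<le> 1" "norm (alg_dilation A r v) = 1"
      using alg_dilation_meets_sphere[OF A v(2)] .
    have "n u \<le> n (alg_dilation A r v)" using u(2) r(3) by simp
    also have "\<dots> \<le> n v"
      using hom[OF r(1)] r(2) nonneg[of v] by (simp add: mult_left_le_one_le r(1) less_imp_le)
    finally show False using v(1) nu by simp
  qed
  then have "emeasure lborel {v. n v \<le> n u / 2} < \<infinity>"
    by (meson bounded_ball bounded_subset emeasure_bounded_finite)
  then have fin: "emeasure lborel {v. n v \<le> 1} < \<infinity>"
    using scale[of "n u / 2"] nu by (auto simp: ennreal_mult_less_top)
  have "0 \<in> {v. n v < 1}" using zero[of 0] by simp
  then have "0 < emeasure lborel {v. n v < 1}"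
    using open_Collect_less[OF cont continuous_on_const] by (intro emeasure_lborel_open_pos) auto
  also have "\<dots> \<le> emeasure lborel {v. n v \<le> 1}"
    using meas by (intro emeasure_mono) auto
  finally obtain V where V: "0 < V" "emeasure lborel {v. n v \<le> 1} = ennreal V"
    using fin ennreal_positive_finiteE by blast
  show ?thesis
  proof
    show "0 < V" by (fact V)
    fix s :: real assume "0 < s"
    then show "emeasure lborel {v. n v \<le> s} = ennreal (V * s powr op_trace A)"
      using scale[of s] V by (simp only: ennreal_mult mult.commute less_imp_le powr_ge_zero)
  qed
qed

section \<open>Integrals over dyadic shells\<close>

lemma dyadic_shell_index:
  fixes t R :: real
  assumes "0 < t" "0 < R"
  shows "2 powi k * R < t \<and> t \<le> 2 powi (k + 1) * R \<longleftrightarrow> k = \<lceil>log 2 (t / R)\<rceil> - 1"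
proof -
  have less: "2 powi j * R < t \<longleftrightarrow> of_int j < log 2 (t / R)" for j :: int
    using assms by (simp add: less_log_iff pos_less_divide_eq powr_real_of_int')
  have "t \<le> 2 powi (k + 1) * R \<longleftrightarrow> log 2 (t / R) \<le> of_int (k + 1)"
    using less[of "k + 1"] by linarith
  with less[of k] show ?thesis
    by (simp add: eq_diff_eq ceiling_eq_iff eq_commute[of _ "\<lceil>_\<rceil>"])
qed

lemma nn_integral_count_space_eq_infsum:
  fixes f :: "'a \<Rightarrow> real"
  assumes "f summable_on A" "\<And>x. x \<in> A \<Longrightarrow> 0 \<le> f x"
  shows "(\<integral>\<^sup>+x. ennreal (f x) \<partial>count_space A) = ennreal (infsum f A)"
proof -
  have "(\<lambda>x. norm (f x)) summable_on A"
    using assms by (simp cong: summable_on_cong)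
  then have "Infinite_Set_Sum.abs_summable_on f A"
    using abs_summable_equivalent by blast
  then show ?thesis
    using assms(2) by (simp add: nn_integral_conv_infsetsum infsetsum_infsum)
qed

text \<open>The measure of the shell \<open>s\<^sub>k < n \<le> 2 s\<^sub>k\<close> with \<open>s\<^sub>k = 2\<^sup>k R\<close> is \<open>C s\<^sub>k\<^sup>Q\<close>, and on it \<open>F \<circ> n\<close> lies between
\<open>F(2 s\<^sub>k) \<ge> \<kappa> F(s\<^sub>k)\<close> and \<open>F(s\<^sub>k)\<close>. The shells partition \<open>{n > 0}\<close> for every \<open>R\<close>, and the constants
\<open>C\<close> and \<open>\<kappa> C\<close> obtained this way do not involve \<open>R\<close>. The normalisation \<open>F s = 0\<close> for \<open>s \<le> 0\<close>
discards the null set outside the shells.\<close>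

lemma nn_integral_dyadic_shells:
  fixes n :: "'a \<Rightarrow> real" and F :: "real \<Rightarrow> real"
  assumes n[measurable]: "n \<in> borel_measurable M" and F[measurable]: "F \<in> borel_measurable borel"
    and V: "0 < V" and Q: "0 < Q"
    and vol: "\<And>s. 0 < s \<Longrightarrow> emeasure M {x \<in> space M. n x \<le> s} = ennreal (V * s powr Q)"
    and F_nonneg: "\<And>s. 0 \<le> F s" and F_nonpos: "\<And>s. s \<le> 0 \<Longrightarrow> F s = 0"
    and F_antimono: "\<And>s t. 0 < s \<Longrightarrow> s \<le> t \<Longrightarrow> F t \<le> F s"
    and \<kappa>: "0 \<le> \<kappa>" and F_doubling: "\<And>s. 0 < s \<Longrightarrow> \<kappa> * F s \<le> F (2 * s)"
    and R: "0 < R"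
    and summable: "(\<lambda>k::int. F (2 powi k * R) * (2 powi k * R) powr Q) summable_on UNIV"
  defines "C \<equiv> V * (2 powr Q - 1)"
    and "S \<equiv> (\<Sum>\<^sub>\<infinity>k::int\<in>UNIV. F (2 powi k * R) * (2 powi k * R) powr Q)"
  shows "(\<integral>\<^sup>+x. ennreal (F (n x)) \<partial>M) \<le> ennreal (C * S)"
    and "ennreal (\<kappa> * C * S) \<le> (\<integral>\<^sup>+x. ennreal (F (n x)) \<partial>M)"
proof -
  define s :: "int \<Rightarrow> real" where "s k = 2 powi k * R" for k
  define Sh where "Sh k = {x \<in> space M. s k < n x \<and> n x \<le> 2 * s k}" for k
  have s_pos: "0 < s k" for k using R by (simp add: s_def)
  have [measurable]: "Sh k \<in> sets M" for k unfolding Sh_def by measurable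
  have C_nonneg: "0 \<le> C" using V Q by (auto simp: C_def intro!: mult_nonneg_nonneg ge_one_powr_ge_zero)
  have S_eq: "S = (\<Sum>\<^sub>\<infinity>k\<in>UNIV. F (s k) * s k powr Q)" by (simp add: S_def s_def)
  have smb: "(\<lambda>k. F (s k) * s k powr Q) summable_on UNIV"
    using summable by (simp add: s_def)
  have vol_shell: "emeasure M (Sh k) = ennreal (C * s k powr Q)" for k
  proof -
    have "Sh k = {x \<in> space M. n x \<le> 2 * s k} - {x \<in> space M. n x \<le> s k}"
      by (auto simp: Sh_def)
    also have "emeasure M \<dots> = emeasure M {x \<in> space M. n x \<le> 2 * s k} - emeasure M {x \<in> space M. n x \<le> s k}"
      by (rule emeasure_Diff) (use s_pos[of k] vol[OF s_pos[of k]] in auto)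
    also have "\<dots> = ennreal (V * (2 * s k) powr Q - V * s k powr Q)"
      using vol[of "2 * s k"] vol[of "s k"] s_pos[of k] V by (simp add: ennreal_minus)
    also have "V * (2 * s k) powr Q - V * s k powr Q = C * s k powr Q"
      using s_pos[of k] by (simp add: C_def powr_mult algebra_simps)
    finally show ?thesis .
  qed
  have integral_shells: "(\<integral>\<^sup>+x. ennreal (F (n x)) \<partial>M) =
      (\<integral>\<^sup>+k. (\<integral>\<^sup>+x. ennreal (F (n x)) * indicator (Sh k) x \<partial>M) \<partial>count_space UNIV)"
  proof -
    have "ennreal (F (n x)) = (\<integral>\<^sup>+k. ennreal (F (n x)) * indicator (Sh k) x \<partial>count_space UNIV)"
      if x: "x \<in> space M" for x
    proof (cases "n x \<le> 0")
      case True
      then show ?thesis by (simp add: F_nonpos)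
    next
      case False
      define j where "j = \<lceil>log 2 (n x / R)\<rceil> - 1"
      have "x \<in> Sh k \<longleftrightarrow> k = j" for k
        using dyadic_shell_index[of "n x" R k] False R x
        by (simp add: Sh_def s_def j_def power_int_add mult_ac)
      then have "indicator (Sh k) x = (indicator {j} k :: ennreal)" for k
        by (simp add: indicator_def)
      then show ?thesis
        by (simp add: nn_integral_cmult)
    qed
    then have "(\<integral>\<^sup>+x. ennreal (F (n x)) \<partial>M) =
        (\<integral>\<^sup>+x. (\<integral>\<^sup>+k. ennreal (F (n x)) * indicator (Sh k) x \<partial>count_space UNIV) \<partial>M)"
      by (intro nn_integral_cong)
    also have "\<dots> = (\<integral>\<^sup>+k. (\<integral>\<^sup>+x. ennreal (F (n x)) * indicator (Sh k) x \<partial>M) \<partial>count_space UNIV)"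
      by (rule nn_integral_count_space_nn_integral) auto
    finally show ?thesis .
  qed
  have const_shell: "(\<integral>\<^sup>+x. ennreal c * indicator (Sh k) x \<partial>M) = ennreal (c * C * s k powr Q)"
    if "0 \<le> c" for c k
    using that C_nonneg by (simp add: nn_integral_cmult_indicator vol_shell mult.assoc flip: ennreal_mult)
  have sum_shells: "(\<integral>\<^sup>+k. ennreal (c * F (s k) * C * s k powr Q) \<partial>count_space UNIV) = ennreal (c * C * S)"
    if "0 \<le> c" for c
  proof -
    have *: "c * F (s k) * C * s k powr Q = c * C * (F (s k) * s k powr Q)" for k by simp
    have "(\<integral>\<^sup>+k. ennreal (c * C * (F (s k) * s k powr Q)) \<partial>count_space UNIV) =
        ennreal (\<Sum>\<^sub>\<infinity>k\<in>UNIV. c * C * (F (s k) * s k powr Q))"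
      by (rule nn_integral_count_space_eq_infsum)
         (use that C_nonneg F_nonneg in \<open>auto intro!: summable_on_cmult_right smb mult_nonneg_nonneg\<close>)
    also have "(\<Sum>\<^sub>\<infinity>k\<in>UNIV. c * C * (F (s k) * s k powr Q)) = c * C * S"
      unfolding S_eq by (rule infsum_cmult_right) (rule smb)
    finally show ?thesis unfolding * .
  qed
  have "(\<integral>\<^sup>+x. ennreal (F (n x)) * indicator (Sh k) x \<partial>M) \<le> ennreal (1 * F (s k) * C * s k powr Q)" for k
  proof -
    have "(\<integral>\<^sup>+x. ennreal (F (n x)) * indicator (Sh k) x \<partial>M) \<le>
        (\<integral>\<^sup>+x. ennreal (F (s k)) * indicator (Sh k) x \<partial>M)"
      by (intro nn_integral_mono)
         (use F_antimono[OF s_pos[of k]] in \<open>auto simp: Sh_def indicator_def intro!: ennreal_leI\<close>)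
    then show ?thesis by (simp add: const_shell[OF F_nonneg])
  qed
  then have "(\<integral>\<^sup>+x. ennreal (F (n x)) \<partial>M) \<le> ennreal (1 * C * S)"
    unfolding integral_shells sum_shells[of 1, OF zero_le_one, symmetric] by (intro nn_integral_mono)
  then show "(\<integral>\<^sup>+x. ennreal (F (n x)) \<partial>M) \<le> ennreal (C * S)" by simp
  have "ennreal (\<kappa> * F (s k) * C * s k powr Q) \<le> (\<integral>\<^sup>+x. ennreal (F (n x)) * indicator (Sh k) x \<partial>M)" for k
  proof -
    have "\<kappa> * F (s k) \<le> F (n x)" if "x \<in> Sh k" for x
      using F_doubling[OF s_pos[of k]] F_antimono[of "n x" "2 * s k"] s_pos[of k] that
      by (auto simp: Sh_def)
    then have "(\<integral>\<^sup>+x. ennreal (\<kappa> * F (s k)) * indicator (Sh k) x \<partial>M) \<le>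
        (\<integral>\<^sup>+x. ennreal (F (n x)) * indicator (Sh k) x \<partial>M)"
      by (intro nn_integral_mono) (auto simp: indicator_def intro!: ennreal_leI)
    then show ?thesis using \<kappa> by (simp add: const_shell F_nonneg)
  qed
  then show "ennreal (\<kappa> * C * S) \<le> (\<integral>\<^sup>+x. ennreal (F (n x)) \<partial>M)"
    unfolding integral_shells sum_shells[OF \<kappa>, symmetric] by (intro nn_integral_mono)
qed

lemma summable_on_int_two_sided:
  fixes f :: "int \<Rightarrow> real"
  assumes nonneg: "\<And>k. 0 \<le> f k"
    and pos: "\<And>k. 0 \<le> k \<Longrightarrow> f k \<le> c * q powi k" and q: "0 < q" "q < 1"
    and neg: "\<And>k. k \<le> 0 \<Longrightarrow> f k \<le> d * r powi k" and r: "1 < r"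
  shows "f summable_on UNIV"
proof -
  have geom: "(\<lambda>m. f (h m)) summable_on UNIV"
    if "\<And>m. f (h m) \<le> e * t ^ m" "0 < t" "t < 1" for h :: "nat \<Rightarrow> int" and e t
  proof -
    have "summable (\<lambda>m. e * t ^ m)"
      using that(2,3) by (intro summable_mult summable_geometric) auto
    then have "summable (\<lambda>m. f (h m))"
      by (rule summable_comparison_test') (use that(1) nonneg in auto)
    then show ?thesis
      using nonneg by (simp add: summable_on_UNIV_nonneg_real_iff)
  qed
  have "(\<lambda>m. f (int m)) summable_on UNIV"
    by (rule geom[of _ c q]) (use pos[of "int _"] q in auto)
  moreover have "inj (\<lambda>m. int m)" by (simp add: inj_on_def)
  ultimately have 1: "f summable_on range int"
    by (simp add: summable_on_reindex o_def)
  have "(\<lambda>m. f (- int m)) summable_on UNIV"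
    by (rule geom[of _ d "inverse r"])
       (use neg[of "- int _"] r in \<open>auto simp: power_int_minus power_inverse inverse_less_1_iff\<close>)
  moreover have "inj (\<lambda>m. - int m)" by (simp add: inj_on_def)
  ultimately have 2: "f summable_on range (\<lambda>m. - int m)"
    by (simp add: summable_on_reindex o_def)
  have "(UNIV :: int set) = range int \<union> range (\<lambda>m. - int m)"
    by (auto simp: image_iff) (metis int_cases2)
  then show ?thesis
    using summable_on_union[OF 1 2] by simp
qed

text \<open>Geometric decay in both directions: with \<open>s = 2\<^sup>k R\<close> the summand is at most \<open>s powr (\<beta> - c)\<close>, which
is good for large \<open>k\<close>, and at most \<open>s powr \<beta>\<close>, which is good for negative \<open>k\<close>.\<close>

lemma summable_dyadic_kernel:
  fixes \<beta> c R :: real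
  assumes R: "0 < R" and \<beta>: "0 < \<beta>" and c: "\<beta> < c"
  shows "(\<lambda>k::int. (2 powi k * R) powr \<beta> / (1 + 2 powi k * R) powr c) summable_on UNIV"
proof (rule summable_on_int_two_sided)
  have split: "(2 powi k * R) powr t = R powr t * (2 powr t) powi k" for k :: int and t
    using R by (simp add: powr_mult powr_powr mult.commute flip: powr_real_of_int')
  fix k :: int
  let ?s = "2 powi k * R"
  have s: "0 < ?s" using R by simp
  show "0 \<le> ?s powr \<beta> / (1 + ?s) powr c" by simp
  have "?s powr \<beta> / (1 + ?s) powr c \<le> ?s powr \<beta> / ?s powr c"
    using s \<beta> c by (intro divide_left_mono powr_mono2 mult_pos_pos) auto
  then show "?s powr \<beta> / (1 + ?s) powr c \<le> R powr (\<beta> - c) * (2 powr (\<beta> - c)) powi k"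
    by (simp add: split powr_diff power_int_divide_distrib)
  have "?s powr \<beta> / (1 + ?s) powr c \<le> ?s powr \<beta> / 1"
    using s \<beta> c by (intro divide_left_mono) (auto intro!: ge_one_powr_ge_zero)
  then show "?s powr \<beta> / (1 + ?s) powr c \<le> R powr \<beta> * (2 powr \<beta>) powi k"
    by (simp add: split)
qed (use \<beta> c in \<open>auto simp: powr_less_one\<close>)

lemma kernel_profile_antimono:
  fixes a c s t :: real
  assumes "a \<le> 0" "0 \<le> c" "0 < s" "s \<le> t"
  shows "t powr a / (1 + t) powr c \<le> s powr a / (1 + s) powr c"
  using assms by (intro frac_le powr_mono2' powr_mono2) auto

text \<open>Because \<open>1 + 2 * s \<le> 2 * (1 + s)\<close>.\<close>

lemma kernel_profile_doubling:
  fixes a c s :: real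
  assumes "0 \<le> c" "0 < s"
  shows "2 powr (a - c) * (s powr a / (1 + s) powr c) \<le> (2 * s) powr a / (1 + 2 * s) powr c"
proof -
  have "2 powr (a - c) * (s powr a / (1 + s) powr c) = (2 * s) powr a / (2 * (1 + s)) powr c"
    using assms by (simp only: powr_mult powr_diff) simp
  also have "\<dots> \<le> (2 * s) powr a / (1 + 2 * s) powr c"
    using assms by (intro divide_left_mono powr_mono2 mult_pos_pos) auto
  finally show ?thesis .
qed

section \<open>The kernel on a homogeneous group\<close>

lemma (in homogeneous_group) continuous_exp: "continuous_on UNIV E"
  using E_smooth by (simp add: smooth_map_def)

lemma (in homogeneous_group) exp_zero: "E 0 = \<one>\<^bsub>G\<^esub>"
proof -
  have "E 0 \<otimes>\<^bsub>G\<^esub> E 0 = E 0"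
    using E_add[of 0 0 0] by simp
  then show ?thesis
    using carrier_UNIV by (metis UNIV_I r_cancel_one)
qed

text \<open>Haar measure is Lebesgue measure in exponential coordinates, so the claim is about the function
\<open>N \<circ> E\<close> on the Lie algebra. It vanishes only at \<open>0\<close> because \<open>E\<close> is injective and maps \<open>0\<close> to the
identity.\<close>

lemma (in homogeneous_group) haar_quasinorm_ball:
  assumes "homogeneous_quasinorm G E A N"
  obtains V where "0 < V"
    "\<And>s. 0 < s \<Longrightarrow> emeasure (haar E) {x. N x \<le> s} = ennreal (V * s powr homogeneous_dim A)"
proof -
  have N: "continuous_on UNIV N" "\<And>x. 0 \<le> N x" "\<And>x. N x = 0 \<longleftrightarrow> x = \<one>\<^bsub>G\<^esub>"
      "\<And>r x. 0 < r \<Longrightarrow> N (dilation E A r x) = r * N x"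
    using assms by (auto simp: homogeneous_quasinorm_def)
  have inv_E: "inv_into UNIV E (E v) = v" for v
    using E_bij by (simp add: bij_def)
  have "continuous_on UNIV (\<lambda>v. N (E v))"
    using continuous_on_compose2[OF N(1) continuous_exp] by simp
  moreover have "N (E v) = 0 \<longleftrightarrow> v = 0" for v
    using N(3) exp_zero E_bij by (metis bij_def inj_eq)
  moreover have "N (E (alg_dilation A r v)) = r * N (E v)" if "0 < r" for r v
    using N(4)[OF that, of "E v"] by (simp add: dilation_def inv_E)
  ultimately obtain V where V: "0 < V"
      "\<And>s. 0 < s \<Longrightarrow> emeasure lborel {v. N (E v) \<le> s} = ennreal (V * s powr op_trace A)"
    using emeasure_homogeneous_sublevel[OF A_linear A_diag, of "\<lambda>v. N (E v)"] N(2) by blast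
  have "E \<in> borel_measurable lborel"
    using borel_measurable_continuous_onI[OF continuous_exp] by simp
  moreover have "{x. N x \<le> s} \<in> sets borel" for s
    using closed_Collect_le[OF N(1) continuous_on_const] by (rule borel_closed)
  ultimately have "emeasure (haar E) {x. N x \<le> s} = emeasure lborel {v. N (E v) \<le> s}" for s
    by (simp add: haar_def emeasure_distr vimage_def)
  with V that show ?thesis by (simp add: homogeneous_dim_def)
qed

theorem theorem2p2:
  fixes G :: "'g::{t2_space, second_countable_topology} monoid"
    and \<A> :: "('g, 'e::euclidean_space) chart set"
    and br :: "'e \<Rightarrow> 'e \<Rightarrow> 'e"
    and E :: "'e \<Rightarrow> 'g"
    and A :: "'e \<Rightarrow> 'e"
    and N :: "'g \<Rightarrow> real"
    and Q \<alpha> \<gamma> p\<^sub>1 :: real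
  assumes "homogeneous_group G \<A> br E A"
    and "Q = homogeneous_dim A"
    and "homogeneous_quasinorm G E A N"
    and "0 < \<alpha>" and "\<alpha> < Q" and "\<gamma> > 0"
    and "Q / (Q + \<gamma> - \<alpha>) < p\<^sub>1" and "p\<^sub>1 < Q / (Q - \<alpha>)"
  shows "BR_kernel N Q \<alpha> \<gamma> \<in> Lp_space p\<^sub>1 (haar E) \<and>
    (\<exists>c\<^sub>1>0. \<exists>c\<^sub>2>0. \<forall>R>0.
      (let a = (\<lambda>k::int. (2 powi k * R) powr ((\<alpha> - Q) * p\<^sub>1 + Q) /
                          (1 + 2 powi k * R) powr (\<gamma> * p\<^sub>1));
           S = (\<Sum>\<^sub>\<infinity>k\<in>UNIV. a k) powr (1 / p\<^sub>1)
       in a summable_on UNIV \<and>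
          c\<^sub>1 * S \<le> Lp_norm p\<^sub>1 (haar E) (BR_kernel N Q \<alpha> \<gamma>) \<and>
          Lp_norm p\<^sub>1 (haar E) (BR_kernel N Q \<alpha> \<gamma>) \<le> c\<^sub>2 * S))"
proof -
  interpret homogeneous_group G \<A> br E A by fact
  let ?M = "haar E" and ?K = "BR_kernel N Q \<alpha> \<gamma>"
  define a c where "a = (\<alpha> - Q) * p\<^sub>1" and "c = \<gamma> * p\<^sub>1"
  \<comment> \<open>The \<open>p\<^sub>1\<close>-th power of the kernel is the radial function \<open>F \<circ> N\<close>.\<close>
  define F where "F s = (if s \<le> 0 then 0 else s powr a / (1 + s) powr c)" for s :: real
  obtain V where V: "0 < V"
      "\<And>s. 0 < s \<Longrightarrow> emeasure ?M {x. N x \<le> s} = ennreal (V * s powr Q)"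
    using haar_quasinorm_ball[OF assms(3)] assms(2) by blast
  define C where "C = V * (2 powr Q - 1)"
  define dyadic where "dyadic R k = (2 powi k * R) powr (a + Q) / (1 + 2 powi k * R) powr c" for R and k :: int
  define T where "T R = (\<Sum>\<^sub>\<infinity>k\<in>UNIV. dyadic R k)" for R
  define I where "I = (LINT x|?M. \<bar>?K x\<bar> powr p\<^sub>1)"

  have Q: "0 < Q" and d: "0 < Q + \<gamma> - \<alpha>" "0 < Q - \<alpha>" using assms by linarith+
  have p: "0 < p\<^sub>1"
    using assms(7) Q d(1) by (meson divide_pos_pos less_trans)
  \<comment> \<open>The upper bound on \<open>p\<^sub>1\<close> says \<open>0 < a + Q\<close> (integrability at the identity), the lower bound
    says \<open>a + Q < c\<close> (integrability at infinity).\<close>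
  have exps: "a \<le> 0" "0 < c" "0 < a + Q" "a + Q < c"
    using p d assms(6-8) by (auto simp: a_def c_def field_simps mult_le_0_iff)
  have C: "0 < C" using V(1) Q by (simp add: C_def)
  have N: "continuous_on UNIV N" "\<And>x. 0 \<le> N x"
    using assms(3) by (auto simp: homogeneous_quasinorm_def)
  have sets_M[measurable_cong]: "sets ?M = sets borel" and space_M: "space ?M = UNIV"
    by (simp_all add: haar_def)
  have N_meas[measurable]: "N \<in> borel_measurable ?M"
    using borel_measurable_continuous_onI[OF N(1)] by (simp cong: measurable_cong_sets add: sets_M)
  have F_meas[measurable]: "F \<in> borel_measurable borel"
    unfolding F_def by measurable
  have K_meas[measurable]: "?K \<in> borel_measurable ?M"
    unfolding BR_kernel_def by measurable
  have K_F: "\<bar>?K x\<bar> powr p\<^sub>1 = F (N x)" for x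
    using N(2)[of x] by (auto simp: BR_kernel_def F_def a_def c_def powr_divide powr_powr)
  have F_dyadic: "F (2 powi k * R) * (2 powi k * R) powr Q = dyadic R k" if "0 < R" for R k
  proof -
    have "0 < 2 powi k * R" using that by simp
    then show ?thesis by (simp add: F_def dyadic_def powr_add)
  qed
  have summable: "dyadic R summable_on UNIV" if "0 < R" for R
    using summable_dyadic_kernel[OF that exps(3,4)] by (simp add: dyadic_def[abs_def])
  have bounds: "(\<integral>\<^sup>+x. ennreal (F (N x)) \<partial>?M) \<le> ennreal (C * T R)"
      "ennreal (2 powr (a - c) * C * T R) \<le> (\<integral>\<^sup>+x. ennreal (F (N x)) \<partial>?M)" if R: "0 < R" for R
  proof -
    have "0 \<le> F s" "s \<le> 0 \<Longrightarrow> F s = 0" for s by (simp_all add: F_def)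
    moreover have "F t \<le> F s" if "0 < s" "s \<le> t" for s t
      using kernel_profile_antimono[of a c s t] exps(1,2) that by (simp add: F_def)
    moreover have "2 powr (a - c) * F s \<le> F (2 * s)" if "0 < s" for s
      using kernel_profile_doubling[of c s a] exps(2) that by (simp add: F_def)
    ultimately show "(\<integral>\<^sup>+x. ennreal (F (N x)) \<partial>?M) \<le> ennreal (C * T R)"
      "ennreal (2 powr (a - c) * C * T R) \<le> (\<integral>\<^sup>+x. ennreal (F (N x)) \<partial>?M)"
      using nn_integral_dyadic_shells[of N ?M F V Q "2 powr (a - c)" R] V Q R summable[OF R]
      by (simp_all add: space_M F_dyadic C_def T_def)
  qed
  have K_int: "integrable ?M (\<lambda>x. \<bar>?K x\<bar> powr p\<^sub>1)"
  proof (rule integrableI_nonneg)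
    show "(\<integral>\<^sup>+x. ennreal (\<bar>?K x\<bar> powr p\<^sub>1) \<partial>?M) < \<infinity>"
      unfolding K_F using bounds(1)[of 1] by (simp add: le_less_trans)
  qed auto
  have I: "(\<integral>\<^sup>+x. ennreal (F (N x)) \<partial>?M) = ennreal I" "0 \<le> I"
    using nn_integral_eq_integral[OF K_int] by (simp_all add: I_def flip: K_F)
  have T_nonneg: "0 \<le> T R" for R
    unfolding T_def by (rule infsum_nonneg) (simp add: dyadic_def)
  have norm_bounds: "(2 powr (a - c) * C) powr (1 / p\<^sub>1) * T R powr (1 / p\<^sub>1) \<le> Lp_norm p\<^sub>1 ?M ?K"
      "Lp_norm p\<^sub>1 ?M ?K \<le> C powr (1 / p\<^sub>1) * T R powr (1 / p\<^sub>1)" if "0 < R" for R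
  proof -
    have "2 powr (a - c) * C * T R \<le> I" "I \<le> C * T R"
      using bounds[OF that] C I T_nonneg[of R] by (simp_all add: I(1))
    then have "(2 powr (a - c) * C * T R) powr (1 / p\<^sub>1) \<le> I powr (1 / p\<^sub>1)"
        "I powr (1 / p\<^sub>1) \<le> (C * T R) powr (1 / p\<^sub>1)"
      using p C I(2) T_nonneg[of R] by (auto intro!: powr_mono2)
    then show "(2 powr (a - c) * C) powr (1 / p\<^sub>1) * T R powr (1 / p\<^sub>1) \<le> Lp_norm p\<^sub>1 ?M ?K"
        "Lp_norm p\<^sub>1 ?M ?K \<le> C powr (1 / p\<^sub>1) * T R powr (1 / p\<^sub>1)"
      using C T_nonneg[of R] by (simp_all add: Lp_norm_def I_def powr_mult)
  qed
  have "?K \<in> Lp_space p\<^sub>1 ?M"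
    using K_int K_meas by (simp add: Lp_space_def)
  moreover have "0 < (2 powr (a - c) * C) powr (1 / p\<^sub>1)" "0 < C powr (1 / p\<^sub>1)"
    using C by simp_all
  ultimately show ?thesis
    unfolding Let_def
    using summable norm_bounds unfolding T_def dyadic_def[abs_def] a_def c_def by blast
qed

end
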